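(* Consider the subgradient-push algorithm (described in the context). Suppose that $\{\mathbb G(t)\}_{t\ge0}$ is uniformly strongly connected by sub-sequences of length $L$ and that $\|g_i(t)\|_2$ is uniformly bounded above by a positive number $G$ for all $i$ and $t$. Let $z^*$ be a minimizer of $f$. 1) If the stepsize $\alpha(t)$ is time-varying and $\{\alpha(t)\}$ is positive, non-increasing, and satisfies $\sum_{t=0}^\infty\alpha(t)=\infty$ and $\sum_{t=0}^\infty\alpha^2(t)<\infty$, then for all $t\ge0$, $$\begin{aligned}f\left(\frac{\sum_{\tau=0}^t\alpha(\tau)\bar z(\tau)}{\sum_{\tau=0}^t\alpha(\tau)}\right)-f(z^* )\le{}&\frac{\|\bar z(0)-z^*\|_2^2+G^2\sum_{\tau=0}^t\alpha^2(\tau)}{\sum_{\tau=0}^t2\alpha(\tau)}+\frac{2G\alpha(0)\sum_{i=1}^n\|\bar z(0)-z_i(0)\|_2}{n\sum_{\tau=0}^t\alpha(\tau)}\\&+\frac{32G}{\eta}\sum_{i=1}^n\big\|x_i(0)-\alpha(0)g_i(0)\big\|_2\,\frac{\sum_{\tau=0}^{t-1}\alpha(\tau)\mu^\tau}{\sum_{\tau=0}^t\alpha(\tau)}\\&+\frac{32nG^2}{\eta(1-\mu)}\,\frac{\sum_{\tau=0}^{t-1}\alpha(\tau)\left(\alpha(0)\mu^{\tau/2}+\alpha(\lceil\frac\tau2\rceil)\right)}{\sum_{\tau=0}^t\alpha(\tau)}.\end{aligned}$$ 2) If the stepsize is fixed and $\alpha(t)=1/\sqrt T$ for $T>0$ steps,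 i.e. $t\in\{0,1,\dots,T-1\}$, then $$\begin{aligned}f\left(\frac{\sum_{\tau=0}^{T-1}\bar z(\tau)}{T}\right)-f(z^* )\le{}&\frac{2G\sum_{i=1}^n\|\bar z(0)-z_i(0)\|_2}{nT}+\frac{\|\bar z(0)-z^*\|_2^2+G^2}{2\sqrt T}\\&+\frac{32G}{\eta(1-\mu)T}\sum_{i=1}^n\Big\|x_i(0)-\frac1{\sqrt T}g_i(0)\Big\|_2+\frac{32nG^2}{\eta(1-\mu)\sqrt T}.\end{aligned}$$ Here $\eta$ and $\mu$ are positive constants (the ones described in the context) which satisfy $\eta\ge\frac1{n^{nL}}$ and $\mu\le\left(1-\frac1{n^{nL}}\right)^{1/L}$, respectively, and $\lceil\cdot\rceil$ denotes the ceiling function.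
   Context: Network and weights. There are $n$ agents, $\mathcal V=\{1,\dots,n\}$. For each integer $t\ge0$, $\mathbb G(t)=(\mathcal V,\mathcal E(t))$ is a directed graph with self-arcs at all vertices. $\mathcal N_i(t)=\{j:(j,i)\in\mathcal E(t)\}$ and $\mathcal N_i^-(t)=\{k:(i,k)\in\mathcal E(t)\}$ are the in- and out-neighbor sets of $i$ (both contain $i$). The weights satisfy: there is a constant $\beta>0$ such that $w_{ij}(t)\ge\beta$ for all $i,t$ and $j\in\mathcal N_i(t)$; $w_{ij}(t)=0$ if $j\notin\mathcal N_i(t)$; and $\sum_{j\in\mathcal N_i^-(t)}w_{ji}(t)=1$ for all $i,t$. $W(t)$ is the $n\times n$ (column stochastic) matrix with entries $w_{ij}(t)$. Uniform strong connectivity. $\{\mathbb G(t)\}$ is uniformly strongly connected by sub-sequences of length $L$ ($L$ a positive integer) if for every $t\ge0$ the union graph $\cup_{k=t}^{t+L-1}\mathbb G(k)$ (vertex set $\mathcal V$, union of the edge sets) is strongly connected. Problem. Each $f_i:\mathbb R^d\to\mathbb R$ is convex (not necessarily differentiable), $f(z)=\frac1n\sum_{i=1}^n f_i(z)$, and the set of minimizers of $f$ is assumed nonempty. A subgradient of a convex $h:\mathbb R^d\to\mathbb R$ at $x$ is a vector $g$ with $h(y)\ge h(x)+g^\top(y-x)$ for all $y\in\mathbb R^d$. Subgradient-push algorithm. With $x_i(0)\in\mathbb R^d$ and $y_i(0)=1$, $$x_i(t+1)=\sum_{j\in\mathcal N_i(t)}w_{ij}(t)\big[x_j(t)-\alpha(t)g_j(t)\big],\qquad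 y_i(t+1)=\sum_{j\in\mathcal N_i(t)}w_{ij}(t)y_j(t),$$ where $\alpha(t)$ is the stepsize and $g_j(t)$ is a subgradient of $f_j$ at $x_j(t)/y_j(t)$. Define $z_i(t)=x_i(t)/y_i(t)$ and $\bar z(t)=\frac1n\sum_{i=1}^n z_i(t)$. Constants. $\eta>0$ is a constant with $n\ge y_i(t)\ge\eta$ for all $i$ and $t$. $\mu<1$ is a constant for which there is a sequence of stochastic vectors $\{v(t)\}$ in $\mathbb R^n$ (nonnegative entries summing to one) with $\big|[W(t)\cdots W(\tau+1)W(\tau)]_{ij}-v_i(t)\big|\le4\mu^{t-\tau}$ for all $i,j\in\mathcal V$ and $t\ge\tau\ge0$, where $[\cdot]_{ij}$ denotes the $ij$th entry of a matrix. Empty sums are $0$.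
   Formalization: The formal theorem additionally assumes that at each average z̄(t) of the run every f_i has some subgradient of norm at most G; bounding only the subgradients g_i(t) used by the algorithm does not suffice for the claimed bounds. *)

theory Defs
  imports "HOL-Analysis.Analysis" "Graph_Theory.Digraph_Component"
begin

text \<open>
  The agents are the elements of a finite type \<open>'n\<close>, so \<open>n = CARD('n)\<close>, and the ambient
  space is \<open>real ^ 'd\<close>, whose \<^const>\<open>norm\<close> is the Euclidean norm. A time-varying digraph on
  the agents is given by its arc sets \<open>E t\<close>, and the weight \<open>w\<^sub>i\<^sub>j(t)\<close> is \<open>W t $ i $ j\<close>.
\<close>

definition in_nbrs :: "('n \<times> 'n) set \<Rightarrow> 'n \<Rightarrow> 'n set" where
  "in_nbrs A i = {j. (j, i) \<in> A}"

definition out_nbrs :: "('n \<times> 'n) set \<Rightarrow> 'n \<Rightarrow> 'n set" where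
  "out_nbrs A i = {k. (i, k) \<in> A}"

definition uniformly_strongly_connected :: "(nat \<Rightarrow> ('n \<times> 'n) set) \<Rightarrow> nat \<Rightarrow> bool" where
  "uniformly_strongly_connected E L \<longleftrightarrow>
     (\<forall>t. strongly_connected
            (with_proj \<lparr>pverts = (UNIV :: 'n set), parcs = (\<Union>k\<in>{t..<t + L}. E k)\<rparr>))"

definition push_weights ::
    "(nat \<Rightarrow> ('n::finite \<times> 'n) set) \<Rightarrow> real \<Rightarrow> (nat \<Rightarrow> real ^ 'n ^ 'n) \<Rightarrow> bool" where
  "push_weights E \<beta> W \<longleftrightarrow>
     \<beta> > 0 \<and>
     (\<forall>t i j. j \<in> in_nbrs (E t) i \<longrightarrow> W t $ i $ j \<ge> \<beta>) \<and>
     (\<forall>t i j. j \<notin> in_nbrs (E t) i \<longrightarrow> W t $ i $ j = 0) \<and>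
     (\<forall>t i. (\<Sum>j\<in>out_nbrs (E t) i. W t $ j $ i) = 1)"

definition is_subgradient :: "('a::real_inner \<Rightarrow> real) \<Rightarrow> 'a \<Rightarrow> 'a \<Rightarrow> bool" where
  "is_subgradient h x g \<longleftrightarrow> (\<forall>y. h y \<ge> h x + g \<bullet> (y - x))"

definition average_cost :: "('n::finite \<Rightarrow> 'a \<Rightarrow> real) \<Rightarrow> 'a \<Rightarrow> real" where
  "average_cost f z = (\<Sum>i\<in>UNIV. f i z) / real CARD('n)"

primrec push_y :: "(nat \<Rightarrow> ('n::finite \<times> 'n) set) \<Rightarrow> (nat \<Rightarrow> real ^ 'n ^ 'n) \<Rightarrow>
    nat \<Rightarrow> 'n \<Rightarrow> real" where
  "push_y E W 0 = (\<lambda>i. 1)"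
| "push_y E W (Suc t) = (\<lambda>i. \<Sum>j\<in>in_nbrs (E t) i. W t $ i $ j * push_y E W t j)"

text \<open>
  The recursion is run for an arbitrary direction sequence \<open>g\<close>; that \<open>g t j\<close> is a subgradient
  of \<open>f j\<close> at the current point is imposed separately by \<open>subgradient_steps\<close> below, and only
  for the steps that are actually taken.
\<close>

primrec push_x :: "(nat \<Rightarrow> ('n::finite \<times> 'n) set) \<Rightarrow> (nat \<Rightarrow> real ^ 'n ^ 'n) \<Rightarrow>
    (nat \<Rightarrow> real) \<Rightarrow> (nat \<Rightarrow> 'n \<Rightarrow> real ^ 'd) \<Rightarrow> ('n \<Rightarrow> real ^ 'd) \<Rightarrow>
    nat \<Rightarrow> 'n \<Rightarrow> real ^ 'd" where
  "push_x E W \<alpha> g x0 0 = x0"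
| "push_x E W \<alpha> g x0 (Suc t) =
     (\<lambda>i. \<Sum>j\<in>in_nbrs (E t) i.
        W t $ i $ j *\<^sub>R (push_x E W \<alpha> g x0 t j - \<alpha> t *\<^sub>R g t j))"

definition push_z :: "(nat \<Rightarrow> ('n::finite \<times> 'n) set) \<Rightarrow> (nat \<Rightarrow> real ^ 'n ^ 'n) \<Rightarrow>
    (nat \<Rightarrow> real) \<Rightarrow> (nat \<Rightarrow> 'n \<Rightarrow> real ^ 'd) \<Rightarrow> ('n \<Rightarrow> real ^ 'd) \<Rightarrow>
    nat \<Rightarrow> 'n \<Rightarrow> real ^ 'd" where
  "push_z E W \<alpha> g x0 t i = push_x E W \<alpha> g x0 t i /\<^sub>R push_y E W t i"

definition push_zbar :: "(nat \<Rightarrow> ('n::finite \<times> 'n) set) \<Rightarrow> (nat \<Rightarrow> real ^ 'n ^ 'n) \<Rightarrow>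
    (nat \<Rightarrow> real) \<Rightarrow> (nat \<Rightarrow> 'n \<Rightarrow> real ^ 'd) \<Rightarrow> ('n \<Rightarrow> real ^ 'd) \<Rightarrow>
    nat \<Rightarrow> real ^ 'd" where
  "push_zbar E W \<alpha> g x0 t = (\<Sum>i\<in>UNIV. push_z E W \<alpha> g x0 t i) /\<^sub>R real CARD('n)"

text \<open>
  \<open>I\<close> is the set of steps taken: \<open>UNIV\<close> for an infinite run, \<open>{..<T}\<close> for a run of \<open>T\<close> steps.
\<close>

definition subgradient_steps :: "nat set \<Rightarrow> ('n::finite \<Rightarrow> real ^ 'd \<Rightarrow> real) \<Rightarrow>
    (nat \<Rightarrow> ('n \<times> 'n) set) \<Rightarrow> (nat \<Rightarrow> real ^ 'n ^ 'n) \<Rightarrow>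
    (nat \<Rightarrow> real) \<Rightarrow> (nat \<Rightarrow> 'n \<Rightarrow> real ^ 'd) \<Rightarrow> ('n \<Rightarrow> real ^ 'd) \<Rightarrow> bool" where
  "subgradient_steps I f E W \<alpha> g x0 \<longleftrightarrow>
     (\<forall>t\<in>I. \<forall>j. is_subgradient (f j) (push_z E W \<alpha> g x0 t j) (g t j))"

text \<open>
  The cost is evaluated at the averaged points, so a bound on subgradients is needed there too.
  A bound \<open>norm (g t i) \<le> G\<close> along the trajectory alone does not suffice: with two agents on
  the line, all weights \<open>1/2\<close>, \<open>x\<^sub>1(0) = 0\<close>, \<open>x\<^sub>2(0) = 4\<close>, \<open>\<alpha>(t) = 1/(t+1)\<close>,
  \<open>f\<^sub>1(z) = M * max 0 (z - 1)\<close> and \<open>f\<^sub>2(z) = 8 * \<bar>z + 2\<bar>\<close>, both agents are at the minimizer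
  \<open>-2\<close> after one step, and \<open>G = 8\<close> bounds the subgradients used, whatever \<open>M\<close> is; but the
  cost at the initial average \<open>2\<close> is \<open>M/2 + 16\<close>. The condition below holds whenever \<open>G\<close>
  bounds all subgradients of all \<open>f i\<close>.
\<close>

definition subgradient_bound_at_averages :: "nat set \<Rightarrow> real \<Rightarrow>
    ('n::finite \<Rightarrow> real ^ 'd \<Rightarrow> real) \<Rightarrow>
    (nat \<Rightarrow> ('n \<times> 'n) set) \<Rightarrow> (nat \<Rightarrow> real ^ 'n ^ 'n) \<Rightarrow>
    (nat \<Rightarrow> real) \<Rightarrow> (nat \<Rightarrow> 'n \<Rightarrow> real ^ 'd) \<Rightarrow> ('n \<Rightarrow> real ^ 'd) \<Rightarrow> bool" where
  "subgradient_bound_at_averages I G f E W \<alpha> g x0 \<longleftrightarrow>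
     (\<forall>t\<in>I. \<forall>i. \<exists>s. is_subgradient (f i) (push_zbar E W \<alpha> g x0 t) s \<and> norm s \<le> G)"

text \<open>\<open>W(t) \<cdots> W(\<tau>+1) W(\<tau>)\<close>, meaningful for \<open>\<tau> \<le> t\<close>.\<close>

primrec back_prod :: "(nat \<Rightarrow> real ^ 'n ^ 'n) \<Rightarrow> nat \<Rightarrow> nat \<Rightarrow> real ^ 'n ^ 'n::finite" where
  "back_prod W \<tau> 0 = W 0"
| "back_prod W \<tau> (Suc t) = (if \<tau> \<le> t then W (Suc t) ** back_prod W \<tau> t else W (Suc t))"

definition stochastic_vector :: "real ^ 'n::finite \<Rightarrow> bool" where
  "stochastic_vector v \<longleftrightarrow> (\<forall>i. v $ i \<ge> 0) \<and> (\<Sum>i\<in>UNIV. v $ i) = 1"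

definition mixing_constant :: "(nat \<Rightarrow> real ^ 'n ^ 'n::finite) \<Rightarrow> real \<Rightarrow> bool" where
  "mixing_constant W \<mu> \<longleftrightarrow>
     \<mu> < 1 \<and>
     (\<exists>v. (\<forall>t. stochastic_vector (v t)) \<and>
          (\<forall>\<tau> t i j. \<tau> \<le> t \<longrightarrow> \<bar>back_prod W \<tau> t $ i $ j - v t $ i\<bar> \<le> 4 * \<mu> ^ (t - \<tau>)))"

end

theory Submission
  imports Defs
begin

text \<open>
  Write \<open>u\<^sub>j(t) = x\<^sub>j(t) - \<alpha>(t) g\<^sub>j(t)\<close> and let \<open>xbar(t)\<close> be the mean of the \<open>x\<^sub>i(t)\<close>. Column
  stochasticity preserves total mass, so \<open>xbar\<close> performs an exact averaged subgradient step,
  \<open>xbar(t+1) = xbar(t) - (\<alpha>(t)/n) \<Sum>\<^sub>j g\<^sub>j(t)\<close>, although no agent knows it. Expanding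
  \<open>\<parallel>xbar(t+1) - z\<^sup>*\<parallel>\<^sup>2\<close> gives the usual descent inequality, except that \<open>g\<^sub>j(t)\<close> is a
  subgradient at \<open>z\<^sub>j(t)\<close> while the cost is evaluated at \<open>zbar(t)\<close>. Moving between these
  points costs \<open>G (\<parallel>xbar(t) - z\<^sub>j(t)\<parallel> + \<parallel>zbar(t) - z\<^sub>j(t)\<parallel>)\<close> per agent
  (\<open>descent_step\<close>). Telescoping and Jensen's inequality give \<open>ergodic_descent_bound\<close>. At
  time \<open>0\<close> all \<open>y\<^sub>i\<close> are \<open>1\<close>, so \<open>xbar(0) = zbar(0)\<close>, and the two distances agree; this is
  the origin of the factor \<open>2\<close> in the second summand of the bounds.

  What remains is to bound \<open>\<parallel>z\<^sub>i(t+1) - xbar(t+1)\<parallel>\<close>. Unrolling the linear recursions writes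
  \<open>x\<^sub>i(t+1)\<close> as a combination of the vectors injected into the network, \<open>u\<^sub>j(0)\<close> at time \<open>0\<close>
  and \<open>- \<alpha>(s) g\<^sub>j(s)\<close> at times \<open>s \<ge> 1\<close>, with the entries of \<open>W(t) \<cdots> W(s)\<close> as coefficients;
  \<open>y\<^sub>i(t+1)\<close> is the row sum of \<open>W(t) \<cdots> W(0)\<close>, and \<open>n xbar(t+1)\<close> is the plain sum of all
  injected vectors. By the mixing hypothesis both a coefficient and \<open>y\<^sub>i(t+1)/n\<close> are close to the same number
  \<open>v\<^sub>i(t)\<close>, so they differ by at most \<open>8 \<mu>\<^bsup>t-s\<^esup>\<close>. Hence the disagreement
  \<open>\<parallel>x\<^sub>i(t+1) - y\<^sub>i(t+1) xbar(t+1)\<parallel>\<close> is at most \<open>8 \<Sum>\<^sub>s \<mu>\<^bsup>t-s\<^esup> \<Sum>\<^sub>j \<parallel>d\<^sub>j(s)\<parallel>\<close>, where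
  \<open>d(s)\<close> is the injection at time \<open>s\<close> (\<open>ratio_disagreement\<close>), and division by
  \<open>y\<^sub>i(t+1) \<ge> \<eta>\<close> transfers this to \<open>z\<^sub>i\<close>. By the triangle inequality the
  two distances in the descent inequality together are at most three times the resulting bound,
  and \<open>3 \<cdot> 8 \<le> 32\<close>.

  The two step size rules differ only in the estimate of the convolution
  \<open>\<Sum>\<^sub>s \<alpha>(s) \<mu>\<^bsup>t-s\<^esup>\<close>: a geometric sum for constant steps, and a split at \<open>s = \<lceil>t/2\<rceil>\<close> for
  non-increasing ones (\<open>geometric_convolution_split\<close>).
\<close>

section \<open>Linear recursions over column stochastic weights\<close>

lemma in_nbrs_weighted_sum:
  fixes W :: "nat \<Rightarrow> real ^ 'n ^ 'n::finite" and h :: "'n \<Rightarrow> 'a::real_vector"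
  assumes "push_weights E \<beta> W"
  shows "(\<Sum>j\<in>in_nbrs (E t) i. W t $ i $ j *\<^sub>R h j) = (\<Sum>j\<in>UNIV. W t $ i $ j *\<^sub>R h j)"
  using assms by (intro sum.mono_neutral_left) (auto simp: push_weights_def)

lemma push_weights_column_sum:
  fixes W :: "nat \<Rightarrow> real ^ 'n ^ 'n::finite"
  assumes "push_weights E \<beta> W"
  shows "(\<Sum>i\<in>UNIV. W t $ i $ j) = 1"
proof -
  have "(\<Sum>i\<in>UNIV. W t $ i $ j) = (\<Sum>i\<in>out_nbrs (E t) j. W t $ i $ j)"
    using assms
    by (intro sum.mono_neutral_right) (auto simp: push_weights_def in_nbrs_def out_nbrs_def)
  then show ?thesis
    using assms by (simp add: push_weights_def)
qed

lemma column_stochastic_sum: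
  fixes A :: "real ^ 'n ^ 'n::finite" and h :: "'n \<Rightarrow> 'a::real_vector"
  assumes "\<And>j. (\<Sum>i\<in>UNIV. A $ i $ j) = 1"
  shows "(\<Sum>i\<in>UNIV. \<Sum>j\<in>UNIV. A $ i $ j *\<^sub>R h j) = (\<Sum>j\<in>UNIV. h j)"
proof -
  have "(\<Sum>i\<in>UNIV. \<Sum>j\<in>UNIV. A $ i $ j *\<^sub>R h j) = (\<Sum>j\<in>UNIV. (\<Sum>i\<in>UNIV. A $ i $ j) *\<^sub>R h j)"
    by (subst sum.swap) (simp add: scaleR_sum_left)
  then show ?thesis
    using assms by simp
qed

lemma back_prod_refl: "back_prod W t t = W t"
  by (cases t) auto

text \<open>
  The sequence \<open>d\<close> collects what is injected into the network: \<open>d 0\<close> is the whole state that the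
  first matrix acts on, and \<open>d (Suc t)\<close> is added to the state before the next matrix acts. With
  this convention the coordinates of the state and the push-sum weights are instances of the same
  recursion.
\<close>

lemma unrolled_recursion:
  fixes W :: "nat \<Rightarrow> real ^ 'n ^ 'n::finite" and X d :: "nat \<Rightarrow> 'n \<Rightarrow> 'a::real_vector"
  assumes first: "\<And>i. X (Suc 0) i = (\<Sum>j\<in>UNIV. W 0 $ i $ j *\<^sub>R d 0 j)"
    and step: "\<And>t i. X (Suc (Suc t)) i =
                 (\<Sum>j\<in>UNIV. W (Suc t) $ i $ j *\<^sub>R (X (Suc t) j + d (Suc t) j))"
  shows "X (Suc t) i = (\<Sum>s\<le>t. \<Sum>j\<in>UNIV. back_prod W s t $ i $ j *\<^sub>R d s j)"
proof (induction t arbitrary: i)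
  case 0
  then show ?case by (simp add: first)
next
  case (Suc t)
  have *: "(\<Sum>k\<in>UNIV. W (Suc t) $ i $ k *\<^sub>R (\<Sum>j\<in>UNIV. back_prod W s t $ k $ j *\<^sub>R d s j)) =
      (\<Sum>j\<in>UNIV. back_prod W s (Suc t) $ i $ j *\<^sub>R d s j)" if "s \<le> t" for s
  proof -
    have "(\<Sum>k\<in>UNIV. W (Suc t) $ i $ k *\<^sub>R (\<Sum>j\<in>UNIV. back_prod W s t $ k $ j *\<^sub>R d s j)) =
        (\<Sum>k\<in>UNIV. \<Sum>j\<in>UNIV. (W (Suc t) $ i $ k * back_prod W s t $ k $ j) *\<^sub>R d s j)"
      by (simp add: scaleR_sum_right)
    also have "\<dots> =
        (\<Sum>j\<in>UNIV. \<Sum>k\<in>UNIV. (W (Suc t) $ i $ k * back_prod W s t $ k $ j) *\<^sub>R d s j)"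
      by (rule sum.swap)
    also have "\<dots> = (\<Sum>j\<in>UNIV. back_prod W s (Suc t) $ i $ j *\<^sub>R d s j)"
      using that by (simp add: matrix_matrix_mult_def scaleR_sum_left)
    finally show ?thesis .
  qed
  have "X (Suc (Suc t)) i =
      (\<Sum>k\<in>UNIV. W (Suc t) $ i $ k *\<^sub>R
         (\<Sum>s\<le>t. \<Sum>j\<in>UNIV. back_prod W s t $ k $ j *\<^sub>R d s j)) +
      (\<Sum>j\<in>UNIV. W (Suc t) $ i $ j *\<^sub>R d (Suc t) j)"
    by (simp add: step Suc.IH scaleR_add_right sum.distrib)
  also have "(\<Sum>k\<in>UNIV. W (Suc t) $ i $ k *\<^sub>R
         (\<Sum>s\<le>t. \<Sum>j\<in>UNIV. back_prod W s t $ k $ j *\<^sub>R d s j)) =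
      (\<Sum>s\<le>t. \<Sum>k\<in>UNIV. W (Suc t) $ i $ k *\<^sub>R (\<Sum>j\<in>UNIV. back_prod W s t $ k $ j *\<^sub>R d s j))"
    unfolding scaleR_sum_right[of _ _ "{..t}"] by (rule sum.swap)
  also have "\<dots> = (\<Sum>s\<le>t. \<Sum>j\<in>UNIV. back_prod W s (Suc t) $ i $ j *\<^sub>R d s j)"
    by (intro sum.cong refl *) simp
  finally show ?case
    by (simp add: back_prod_refl)
qed

lemma conserved_mass:
  fixes W :: "nat \<Rightarrow> real ^ 'n ^ 'n::finite" and X d :: "nat \<Rightarrow> 'n \<Rightarrow> 'a::real_vector"
  assumes cols: "\<And>t j. (\<Sum>i\<in>UNIV. W t $ i $ j) = 1"
    and first: "\<And>i. X (Suc 0) i = (\<Sum>j\<in>UNIV. W 0 $ i $ j *\<^sub>R d 0 j)"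
    and step: "\<And>t i. X (Suc (Suc t)) i =
                 (\<Sum>j\<in>UNIV. W (Suc t) $ i $ j *\<^sub>R (X (Suc t) j + d (Suc t) j))"
  shows "(\<Sum>i\<in>UNIV. X (Suc t) i) = (\<Sum>s\<le>t. \<Sum>j\<in>UNIV. d s j)"
proof (induction t)
  case 0
  show ?case
    using column_stochastic_sum[OF cols] by (simp add: first)
next
  case (Suc t)
  show ?case
    unfolding step column_stochastic_sum[OF cols] by (simp add: sum.distrib Suc.IH)
qed

text \<open>
  The coefficient of \<open>d s j\<close> in \<open>X i - (Y i / n) \<Sum>\<^sub>k X k\<close> is \<open>[W(t) \<cdots> W(s)]\<^sub>i\<^sub>j - Y i / n\<close>. The
  number \<open>Y i / n\<close> is the mean of row \<open>i\<close> of \<open>W(t) \<cdots> W(0)\<close>, hence within \<open>4 \<mu>\<^sup>t\<close> of \<open>v\<^sub>i(t)\<close>,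
  while the entry is within \<open>4 \<mu>\<^bsup>t-s\<^esup>\<close> of it. Comparing coefficients one by one, instead of
  comparing \<open>X\<close> and \<open>Y\<close> separately with \<open>v\<close>, makes every injected vector decay with its own age;
  the separate comparison would leave a term of the order \<open>\<mu>\<^sup>t \<Sum>\<^sub>s \<alpha>(s)\<close>.
\<close>

lemma ratio_disagreement:
  fixes W :: "nat \<Rightarrow> real ^ 'n ^ 'n::finite" and X d :: "nat \<Rightarrow> 'n \<Rightarrow> 'a::real_normed_vector"
    and Y :: "nat \<Rightarrow> 'n \<Rightarrow> real"
  assumes mixing: "mixing_constant W \<mu>" and \<mu>: "\<mu> > 0"
    and cols: "\<And>t j. (\<Sum>i\<in>UNIV. W t $ i $ j) = 1"
    and first: "\<And>i. X (Suc 0) i = (\<Sum>j\<in>UNIV. W 0 $ i $ j *\<^sub>R d 0 j)"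
    and step: "\<And>t i. X (Suc (Suc t)) i =
                 (\<Sum>j\<in>UNIV. W (Suc t) $ i $ j *\<^sub>R (X (Suc t) j + d (Suc t) j))"
    and Y: "Y (Suc t) i = (\<Sum>j\<in>UNIV. back_prod W 0 t $ i $ j)"
  shows "norm (X (Suc t) i - Y (Suc t) i *\<^sub>R ((\<Sum>k\<in>UNIV. X (Suc t) k) /\<^sub>R real CARD('n)))
         \<le> 8 * (\<Sum>s\<le>t. \<mu> ^ (t - s) * (\<Sum>j\<in>UNIV. norm (d s j)))"
proof -
  obtain v where v: "\<And>\<tau> t i j. \<tau> \<le> t \<Longrightarrow> \<bar>back_prod W \<tau> t $ i $ j - v t $ i\<bar> \<le> 4 * \<mu> ^ (t - \<tau>)"
    and \<mu>1: "\<mu> < 1"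
    using mixing unfolding mixing_constant_def by blast
  define q where "q = Y (Suc t) i / real CARD('n)"
  have "q - v t $ i = (\<Sum>j\<in>UNIV. back_prod W 0 t $ i $ j - v t $ i) / real CARD('n)"
    by (simp add: q_def Y sum_subtractf field_simps)
  also have "\<bar>\<dots>\<bar> \<le> (\<Sum>j\<in>(UNIV::'n set). 4 * \<mu> ^ t) / real CARD('n)"
    unfolding abs_divide abs_of_nat
    by (intro divide_right_mono order_trans[OF sum_abs] sum_mono) (use v[of 0 t i] in auto)
  finally have q: "\<bar>q - v t $ i\<bar> \<le> 4 * \<mu> ^ t"
    by simp
  have coeff: "\<bar>back_prod W s t $ i $ j - q\<bar> \<le> 8 * \<mu> ^ (t - s)" if "s \<le> t" for s j
  proof -
    have "\<mu> ^ t \<le> \<mu> ^ (t - s)"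
      using \<mu> \<mu>1 by (intro power_decreasing) auto
    then show ?thesis
      using q v[OF that, of i j] by linarith
  qed
  have "X (Suc t) i - Y (Suc t) i *\<^sub>R ((\<Sum>k\<in>UNIV. X (Suc t) k) /\<^sub>R real CARD('n)) =
      X (Suc t) i - q *\<^sub>R (\<Sum>k\<in>UNIV. X (Suc t) k)"
    by (simp add: q_def field_simps)
  also have "\<dots> = (\<Sum>s\<le>t. \<Sum>j\<in>UNIV. (back_prod W s t $ i $ j - q) *\<^sub>R d s j)"
    unfolding conserved_mass[where X = X and d = d, OF cols first step]
    unfolding unrolled_recursion[where X = X and d = d, OF first step]
    by (simp add: scaleR_sum_right scaleR_diff_left sum_subtractf)
  also have "norm \<dots> \<le> (\<Sum>s\<le>t. \<Sum>j\<in>UNIV. 8 * \<mu> ^ (t - s) * norm (d s j))"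
    by (intro sum_norm_le order_trans[OF norm_sum] sum_mono)
      (auto intro!: mult_right_mono coeff)
  also have "\<dots> = 8 * (\<Sum>s\<le>t. \<mu> ^ (t - s) * (\<Sum>j\<in>UNIV. norm (d s j)))"
    by (simp add: sum_distrib_left mult.assoc)
  finally show ?thesis .
qed

section \<open>The averaged subgradient step\<close>

text \<open>
  Here \<open>xb\<close> is the point that moves, \<open>z j\<close> the point where agent \<open>j\<close> takes its subgradient and
  \<open>zb\<close> the point where the cost is measured. Going from \<open>xb\<close> to \<open>z j\<close> uses the bound on \<open>g j\<close>;
  going from \<open>z j\<close> to \<open>zb\<close> uses a bounded subgradient at \<open>zb\<close>.
\<close>

lemma descent_step:
  fixes f :: "'n::finite \<Rightarrow> 'a::real_inner \<Rightarrow> real"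
  assumes subgrad: "\<And>j. is_subgradient (f j) (z j) (g j)"
    and g_le: "\<And>j. norm (g j) \<le> G"
    and bounded: "\<And>j. \<exists>s. is_subgradient (f j) zb s \<and> norm s \<le> G"
    and "a \<ge> 0"
    and xb': "xb' = xb - (a / real CARD('n)) *\<^sub>R (\<Sum>j\<in>UNIV. g j)"
  shows "2 * a * (average_cost f zb - average_cost f w) \<le>
           (norm (xb - w))\<^sup>2 - (norm (xb' - w))\<^sup>2 + G\<^sup>2 * a\<^sup>2 +
           2 * a * (G * (\<Sum>j\<in>UNIV. norm (xb - z j) + norm (zb - z j)) / real CARD('n))"
proof -
  define n where "n = real CARD('n)"
  have n: "n > 0"
    by (simp add: n_def)
  define \<gamma> where "\<gamma> = (\<Sum>j\<in>UNIV. g j) /\<^sub>R n"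
  have \<gamma>_le: "norm \<gamma> \<le> G"
  proof -
    have "norm (\<Sum>j\<in>UNIV. g j) \<le> (\<Sum>j\<in>(UNIV::'n set). G)"
      by (intro sum_norm_le g_le)
    then show ?thesis
      using n by (simp add: \<gamma>_def n_def field_simps)
  qed
  have agent: "f j zb - f j w \<le> g j \<bullet> (xb - w) + G * (norm (xb - z j) + norm (zb - z j))" for j
  proof -
    obtain s where s: "is_subgradient (f j) zb s" "norm s \<le> G"
      using bounded by blast
    have "f j (z j) \<ge> f j zb + s \<bullet> (z j - zb)" "f j w \<ge> f j (z j) + g j \<bullet> (w - z j)"
      using s(1) subgrad[of j] unfolding is_subgradient_def by blast+
    moreover have "\<bar>s \<bullet> (z j - zb)\<bar> \<le> G * norm (zb - z j)"
      using Cauchy_Schwarz_ineq2[of s "z j - zb"] mult_right_mono[OF s(2), of "norm (zb - z j)"]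
      by (simp add: norm_minus_commute)
    moreover have "\<bar>g j \<bullet> (xb - z j)\<bar> \<le> G * norm (xb - z j)"
      using Cauchy_Schwarz_ineq2[of "g j" "xb - z j"]
        mult_right_mono[OF g_le[of j], of "norm (xb - z j)"]
      by simp
    ultimately show ?thesis
      by (simp add: inner_diff_right distrib_left)
  qed
  have "average_cost f zb - average_cost f w = (\<Sum>j\<in>UNIV. f j zb - f j w) / n"
    by (simp add: average_cost_def n_def sum_subtractf diff_divide_distrib)
  also have "\<dots> \<le>
      (\<Sum>j\<in>UNIV. g j \<bullet> (xb - w) + G * (norm (xb - z j) + norm (zb - z j))) / n"
    using n by (intro divide_right_mono sum_mono agent) auto
  also have "\<dots> = \<gamma> \<bullet> (xb - w) + G * (\<Sum>j\<in>UNIV. norm (xb - z j) + norm (zb - z j)) / n"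
    using n by (simp only: sum.distrib sum_distrib_left[symmetric] inner_sum_left[symmetric]
        \<gamma>_def inner_scaleR_left) (simp add: field_simps)
  finally have "2 * a * (average_cost f zb - average_cost f w) \<le>
      2 * a * (\<gamma> \<bullet> (xb - w) + G * (\<Sum>j\<in>UNIV. norm (xb - z j) + norm (zb - z j)) / n)"
    using \<open>a \<ge> 0\<close> by (intro mult_left_mono) auto
  moreover have "(norm (xb' - w))\<^sup>2 = (norm (xb - w))\<^sup>2 - 2 * a * (\<gamma> \<bullet> (xb - w)) + a\<^sup>2 * (norm \<gamma>)\<^sup>2"
  proof -
    have step: "xb' - w = (xb - w) - a *\<^sub>R \<gamma>"
      by (simp add: xb' \<gamma>_def n_def divide_inverse)
    show ?thesis
      unfolding step power2_norm_eq_inner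
      by (simp add: inner_diff_left inner_diff_right inner_commute power2_eq_square
          algebra_simps)
  qed
  moreover have "a\<^sup>2 * (norm \<gamma>)\<^sup>2 \<le> G\<^sup>2 * a\<^sup>2"
    unfolding mult.commute[of "G\<^sup>2"] by (intro mult_left_mono power_mono \<gamma>_le) auto
  ultimately show ?thesis
    by (simp add: n_def distrib_left)
qed

lemma average_cost_Jensen:
  fixes f :: "'n::finite \<Rightarrow> 'a::real_vector \<Rightarrow> real"
  assumes convex: "\<And>i. convex_on UNIV (f i)" and "finite S" "S \<noteq> {}"
    and a: "\<And>t. t \<in> S \<Longrightarrow> a t \<ge> 0" "(\<Sum>t\<in>S. a t) = 1"
  shows "average_cost f (\<Sum>t\<in>S. a t *\<^sub>R p t) \<le> (\<Sum>t\<in>S. a t * average_cost f (p t))"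
proof -
  have "(\<Sum>i\<in>UNIV. f i (\<Sum>t\<in>S. a t *\<^sub>R p t)) \<le> (\<Sum>i\<in>UNIV. \<Sum>t\<in>S. a t * f i (p t))"
    using assms by (intro sum_mono convex_on_sum) auto
  also have "\<dots> = (\<Sum>t\<in>S. a t * (\<Sum>i\<in>UNIV. f i (p t)))"
    by (subst sum.swap) (simp add: sum_distrib_left)
  finally show ?thesis
    by (simp add: average_cost_def divide_right_mono flip: sum_divide_distrib)
qed

lemma ergodic_descent_bound:
  fixes f :: "'n::finite \<Rightarrow> 'a::real_inner \<Rightarrow> real"
  assumes convex: "\<And>i. convex_on UNIV (f i)"
    and subgrad: "\<And>t j. t \<le> m \<Longrightarrow> is_subgradient (f j) (z t j) (g t j)"
    and g_le: "\<And>t j. t \<le> m \<Longrightarrow> norm (g t j) \<le> G"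
    and bounded: "\<And>t j. t \<le> m \<Longrightarrow> \<exists>s. is_subgradient (f j) (zb t) s \<and> norm s \<le> G"
    and \<alpha>_pos: "\<And>t. t \<le> m \<Longrightarrow> \<alpha> t > 0"
    and xb: "\<And>t. xb (Suc t) = xb t - (\<alpha> t / real CARD('n)) *\<^sub>R (\<Sum>j\<in>UNIV. g t j)"
  shows "average_cost f ((\<Sum>t\<le>m. \<alpha> t *\<^sub>R zb t) /\<^sub>R (\<Sum>t\<le>m. \<alpha> t)) - average_cost f w \<le>
           ((norm (xb 0 - w))\<^sup>2 + G\<^sup>2 * (\<Sum>t\<le>m. (\<alpha> t)\<^sup>2)) / (2 * (\<Sum>t\<le>m. \<alpha> t)) +
           G * (\<Sum>t\<le>m. \<alpha> t * ((\<Sum>j\<in>UNIV. norm (xb t - z t j) + norm (zb t - z t j))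
                                 / real CARD('n))) / (\<Sum>t\<le>m. \<alpha> t)"
proof -
  define A where "A = (\<Sum>t\<le>m. \<alpha> t)"
  define \<delta> where "\<delta> t = (\<Sum>j\<in>UNIV. norm (xb t - z t j) + norm (zb t - z t j)) / real CARD('n)" for t
  define \<Delta> where "\<Delta> t = average_cost f (zb t) - average_cost f w" for t
  have A: "A > 0"
    unfolding A_def using \<alpha>_pos by (intro sum_pos) auto
  have "(\<Sum>t\<le>m. 2 * \<alpha> t * \<Delta> t) \<le> (\<Sum>t\<le>m. ((norm (xb t - w))\<^sup>2 - (norm (xb (Suc t) - w))\<^sup>2) +
          G\<^sup>2 * (\<alpha> t)\<^sup>2 + 2 * G * (\<alpha> t * \<delta> t))"
  proof (intro sum_mono)
    fix t assume "t \<in> {..m}"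
    then have "t \<le> m" by simp
    show "2 * \<alpha> t * \<Delta> t \<le> ((norm (xb t - w))\<^sup>2 - (norm (xb (Suc t) - w))\<^sup>2) +
          G\<^sup>2 * (\<alpha> t)\<^sup>2 + 2 * G * (\<alpha> t * \<delta> t)"
      using descent_step[where f = f and z = "z t" and zb = "zb t" and w = w and G = G,
          OF subgrad[OF \<open>t \<le> m\<close>] g_le[OF \<open>t \<le> m\<close>]
          bounded[OF \<open>t \<le> m\<close>] less_imp_le[OF \<alpha>_pos[OF \<open>t \<le> m\<close>]] xb]
      by (simp add: \<Delta>_def \<delta>_def mult_ac)
  qed
  also have "\<dots> = (norm (xb 0 - w))\<^sup>2 - (norm (xb (Suc m) - w))\<^sup>2 +
      G\<^sup>2 * (\<Sum>t\<le>m. (\<alpha> t)\<^sup>2) + 2 * G * (\<Sum>t\<le>m. \<alpha> t * \<delta> t)"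
    using sum_telescope[of "\<lambda>t. (norm (xb t - w))\<^sup>2" m]
    by (simp add: sum.distrib sum_distrib_left)
  also have "\<dots> \<le> (norm (xb 0 - w))\<^sup>2 + G\<^sup>2 * (\<Sum>t\<le>m. (\<alpha> t)\<^sup>2) + 2 * G * (\<Sum>t\<le>m. \<alpha> t * \<delta> t)"
    by simp
  finally have total: "2 * (\<Sum>t\<le>m. \<alpha> t * \<Delta> t) \<le>
      (norm (xb 0 - w))\<^sup>2 + G\<^sup>2 * (\<Sum>t\<le>m. (\<alpha> t)\<^sup>2) + 2 * G * (\<Sum>t\<le>m. \<alpha> t * \<delta> t)"
    by (simp add: sum_distrib_left mult.assoc)
  have "average_cost f ((\<Sum>t\<le>m. \<alpha> t *\<^sub>R zb t) /\<^sub>R A) =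
      average_cost f (\<Sum>t\<le>m. (\<alpha> t / A) *\<^sub>R zb t)"
    by (simp add: scaleR_sum_right divide_inverse mult.commute)
  also have "\<dots> \<le> (\<Sum>t\<le>m. \<alpha> t / A * average_cost f (zb t))"
    using A by (intro average_cost_Jensen convex)
      (auto simp: A_def less_imp_le[OF \<alpha>_pos] simp flip: sum_divide_distrib)
  also have "\<dots> - average_cost f w = (\<Sum>t\<le>m. \<alpha> t * \<Delta> t) / A"
    using A by (simp add: \<Delta>_def right_diff_distrib sum_subtractf sum_divide_distrib[symmetric]
        sum_distrib_right[symmetric] diff_divide_distrib A_def[symmetric])
  also have "\<dots> \<le> ((norm (xb 0 - w))\<^sup>2 + G\<^sup>2 * (\<Sum>t\<le>m. (\<alpha> t)\<^sup>2)) / (2 * A) +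
      G * (\<Sum>t\<le>m. \<alpha> t * \<delta> t) / A"
    using total A by (simp add: field_simps)
  finally show ?thesis
    by (simp add: A_def \<delta>_def)
qed

section \<open>Subgradient-push\<close>

text \<open>
  The vectors injected into the network by the algorithm, in the convention of
  \<open>unrolled_recursion\<close>: the initial values are merged with the first subgradient step.
\<close>

definition push_injection :: "(nat \<Rightarrow> real) \<Rightarrow> (nat \<Rightarrow> 'n \<Rightarrow> 'a) \<Rightarrow> ('n \<Rightarrow> 'a) \<Rightarrow>
    nat \<Rightarrow> 'n \<Rightarrow> 'a::real_vector" where
  "push_injection \<alpha> g x0 t j =
     (if t = 0 then x0 j - \<alpha> 0 *\<^sub>R g 0 j else - (\<alpha> t *\<^sub>R g t j))"

lemma push_y_row_sum:
  fixes W :: "nat \<Rightarrow> real ^ 'n ^ 'n::finite"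
  assumes "push_weights E \<beta> W"
  shows "push_y E W (Suc t) i = (\<Sum>j\<in>UNIV. back_prod W 0 t $ i $ j)"
proof -
  note sum_UNIV = in_nbrs_weighted_sum[OF assms, where 'a = real, simplified]
  have "push_y E W (Suc t) i =
      (\<Sum>s\<le>t. \<Sum>j\<in>UNIV. back_prod W s t $ i $ j *\<^sub>R (if s = 0 then 1 else 0))"
    by (rule unrolled_recursion)
      (simp_all add: sum_UNIV sum_UNIV[where h = "\<lambda>_. 1", simplified])
  also have "\<dots> = (\<Sum>s\<le>t. if s = 0 then \<Sum>j\<in>UNIV. back_prod W s t $ i $ j else 0)"
    by (intro sum.cong) auto
  finally show ?thesis
    by simp
qed

text \<open>
  If every \<open>z\<^sub>j\<close> is within \<open>b\<close> of \<open>xbar\<close>, then so is their mean \<open>zbar\<close>, and \<open>z\<^sub>j\<close> is within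
  \<open>2 b\<close> of \<open>zbar\<close>; each agent thus contributes at most \<open>3 b\<close>. Here \<open>b\<close> comes from
  \<open>ratio_disagreement\<close> with its factor \<open>8\<close>, which makes the constant \<open>24\<close>.
\<close>

lemma push_deviation:
  fixes W :: "nat \<Rightarrow> real ^ 'n ^ 'n::finite" and x0 :: "'n \<Rightarrow> real ^ 'd"
    and \<alpha> :: "nat \<Rightarrow> real" and g :: "nat \<Rightarrow> 'n \<Rightarrow> real ^ 'd"
  assumes weights: "push_weights E \<beta> W"
    and mixing: "mixing_constant W \<mu>" and \<mu>: "\<mu> > 0"
    and \<eta>: "\<eta> > 0" and y_ge: "\<And>t i. \<eta> \<le> push_y E W t i"
  defines "xbar \<equiv> (\<lambda>t. (\<Sum>i\<in>UNIV. push_x E W \<alpha> g x0 t i) /\<^sub>R real CARD('n))"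
    and "z \<equiv> push_z E W \<alpha> g x0" and "zbar \<equiv> push_zbar E W \<alpha> g x0"
  shows "(\<Sum>j\<in>UNIV. norm (xbar (Suc t) - z (Suc t) j) + norm (zbar (Suc t) - z (Suc t) j))
           / real CARD('n) \<le>
         24 / \<eta> * (\<Sum>s\<le>t. \<mu> ^ (t - s) * (\<Sum>j\<in>UNIV. norm (push_injection \<alpha> g x0 s j)))"
proof -
  define b where
    "b = 8 / \<eta> * (\<Sum>s\<le>t. \<mu> ^ (t - s) * (\<Sum>j\<in>UNIV. norm (push_injection \<alpha> g x0 s j)))"
  have near: "norm (z (Suc t) i - xbar (Suc t)) \<le> b" for i
  proof -
    let ?y = "push_y E W (Suc t) i" and ?x = "push_x E W \<alpha> g x0"
    have y: "?y > 0" "\<eta> \<le> ?y"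
      using y_ge[of "Suc t" i] \<eta> by linarith+
    have "norm (?x (Suc t) i - ?y *\<^sub>R ((\<Sum>k\<in>UNIV. ?x (Suc t) k) /\<^sub>R real CARD('n))) \<le>
        8 * (\<Sum>s\<le>t. \<mu> ^ (t - s) * (\<Sum>j\<in>UNIV. norm (push_injection \<alpha> g x0 s j)))"
      by (rule ratio_disagreement[OF mixing \<mu> push_weights_column_sum[OF weights]])
        (simp_all only: push_y_row_sum[OF weights] push_x.simps in_nbrs_weighted_sum[OF weights],
          simp_all add: push_injection_def)
    then have "norm (?x (Suc t) i - ?y *\<^sub>R xbar (Suc t)) \<le> \<eta> * b"
      using \<eta> by (simp add: b_def xbar_def)
    moreover have "?x (Suc t) i - ?y *\<^sub>R xbar (Suc t) = ?y *\<^sub>R (z (Suc t) i - xbar (Suc t))"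
      using y(1) by (simp add: z_def push_z_def scaleR_diff_right del: push_x.simps push_y.simps)
    ultimately have "?y * norm (z (Suc t) i - xbar (Suc t)) \<le> \<eta> * b"
      using y(1) by (simp del: push_x.simps push_y.simps)
    then have "\<eta> * norm (z (Suc t) i - xbar (Suc t)) \<le> \<eta> * b"
      using mult_right_mono[OF y(2) norm_ge_zero] order_trans by blast
    then show ?thesis
      using \<eta> by simp
  qed
  have "zbar (Suc t) - xbar (Suc t) = (\<Sum>i\<in>UNIV. z (Suc t) i - xbar (Suc t)) /\<^sub>R real CARD('n)"
    by (simp add: zbar_def push_zbar_def z_def sum_subtractf scaleR_diff_right sum_constant_scaleR
        del: sum_constant)
  moreover have "norm (\<Sum>i\<in>UNIV. z (Suc t) i - xbar (Suc t)) \<le> (\<Sum>i\<in>(UNIV::'n set). b)"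
    by (intro sum_norm_le near)
  ultimately have near_mean: "norm (zbar (Suc t) - xbar (Suc t)) \<le> b"
    by (simp add: field_simps)
  have "norm (xbar (Suc t) - z (Suc t) j) + norm (zbar (Suc t) - z (Suc t) j) \<le> 3 * b" for j
    using near[of j] near_mean
      norm_triangle_ineq4[of "zbar (Suc t) - xbar (Suc t)" "z (Suc t) j - xbar (Suc t)"]
    by (simp add: norm_minus_commute)
  then have "(\<Sum>j\<in>UNIV. norm (xbar (Suc t) - z (Suc t) j) + norm (zbar (Suc t) - z (Suc t) j)) \<le>
      (\<Sum>j\<in>(UNIV::'n set). 3 * b)"
    by (intro sum_mono)
  then show ?thesis
    by (simp add: b_def field_simps)
qed

text \<open>
  Both step size rules follow from this estimate by bounding the convolution of the powers of \<open>\<mu>\<close>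
  with the sizes of the injections.
\<close>

lemma push_ergodic_bound:
  fixes f :: "'n::finite \<Rightarrow> real ^ 'd \<Rightarrow> real" and W :: "nat \<Rightarrow> real ^ 'n ^ 'n"
    and x0 :: "'n \<Rightarrow> real ^ 'd" and \<alpha> :: "nat \<Rightarrow> real" and g :: "nat \<Rightarrow> 'n \<Rightarrow> real ^ 'd"
  assumes weights: "push_weights E \<beta> W"
    and mixing: "mixing_constant W \<mu>" and \<mu>: "\<mu> > 0"
    and \<eta>: "\<eta> > 0" and y_ge: "\<And>t i. \<eta> \<le> push_y E W t i"
    and convex: "\<And>i. convex_on UNIV (f i)"
    and subgrad: "subgradient_steps {..m} f E W \<alpha> g x0"
    and g_le: "\<And>t i. t \<le> m \<Longrightarrow> norm (g t i) \<le> G"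
    and bounded: "subgradient_bound_at_averages {..m} G f E W \<alpha> g x0"
    and \<alpha>_pos: "\<And>t. t \<le> m \<Longrightarrow> \<alpha> t > 0"
  defines "z \<equiv> push_z E W \<alpha> g x0" and "zbar \<equiv> push_zbar E W \<alpha> g x0"
  shows "average_cost f ((\<Sum>t\<le>m. \<alpha> t *\<^sub>R zbar t) /\<^sub>R (\<Sum>t\<le>m. \<alpha> t)) - average_cost f w \<le>
      ((norm (zbar 0 - w))\<^sup>2 + G\<^sup>2 * (\<Sum>t\<le>m. (\<alpha> t)\<^sup>2)) / (2 * (\<Sum>t\<le>m. \<alpha> t)) +
      2 * G * \<alpha> 0 * (\<Sum>i\<in>UNIV. norm (zbar 0 - z 0 i)) / (real CARD('n) * (\<Sum>t\<le>m. \<alpha> t)) +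
      24 * G / \<eta> * (\<Sum>t<m. \<alpha> (Suc t) *
        (\<Sum>s\<le>t. \<mu> ^ (t - s) * (\<Sum>j\<in>UNIV. norm (push_injection \<alpha> g x0 s j)))) / (\<Sum>t\<le>m. \<alpha> t)"
proof -
  define A where "A = (\<Sum>t\<le>m. \<alpha> t)"
  define xbar where "xbar t = (\<Sum>i\<in>UNIV. push_x E W \<alpha> g x0 t i) /\<^sub>R real CARD('n)" for t
  define \<delta> where
    "\<delta> t = (\<Sum>j\<in>UNIV. norm (xbar t - z t j) + norm (zbar t - z t j)) / real CARD('n)" for t
  define D where "D s = (\<Sum>j\<in>UNIV. norm (push_injection \<alpha> g x0 s j))" for s
  have A: "A > 0"
    unfolding A_def using \<alpha>_pos by (intro sum_pos) auto
  have G: "G \<ge> 0"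
    using g_le[of 0] norm_ge_zero order_trans by blast
  have xbar_step: "xbar (Suc t) = xbar t - (\<alpha> t / real CARD('n)) *\<^sub>R (\<Sum>j\<in>UNIV. g t j)" for t
    unfolding xbar_def push_x.simps in_nbrs_weighted_sum[OF weights]
      column_stochastic_sum[OF push_weights_column_sum[OF weights]]
    by (simp add: sum_subtractf scaleR_diff_right divide_inverse mult.commute
        flip: scaleR_sum_right)
  have start: "xbar 0 = zbar 0"
    by (simp add: xbar_def zbar_def push_zbar_def push_z_def)
  have "\<delta> 0 = 2 * (\<Sum>i\<in>UNIV. norm (zbar 0 - z 0 i)) / real CARD('n)"
    by (simp add: \<delta>_def start flip: sum_distrib_left mult_2)
  moreover have "\<delta> (Suc t) \<le> 24 / \<eta> * (\<Sum>s\<le>t. \<mu> ^ (t - s) * D s)" for t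
    unfolding \<delta>_def xbar_def z_def zbar_def D_def
    by (rule push_deviation[OF weights mixing \<mu> \<eta> y_ge])
  then have "(\<Sum>t<m. \<alpha> (Suc t) * \<delta> (Suc t)) \<le>
      (\<Sum>t<m. \<alpha> (Suc t) * (24 / \<eta> * (\<Sum>s\<le>t. \<mu> ^ (t - s) * D s)))"
    by (intro sum_mono mult_left_mono less_imp_le[OF \<alpha>_pos]) auto
  moreover have "(\<Sum>t\<le>m. \<alpha> t * \<delta> t) = \<alpha> 0 * \<delta> 0 + (\<Sum>t<m. \<alpha> (Suc t) * \<delta> (Suc t))"
    using sum.lessThan_Suc_shift[of "\<lambda>t. \<alpha> t * \<delta> t" m] by (simp add: lessThan_Suc_atMost)
  ultimately have dev: "(\<Sum>t\<le>m. \<alpha> t * \<delta> t) \<le>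
      2 * \<alpha> 0 * (\<Sum>i\<in>UNIV. norm (zbar 0 - z 0 i)) / real CARD('n) +
      24 / \<eta> * (\<Sum>t<m. \<alpha> (Suc t) * (\<Sum>s\<le>t. \<mu> ^ (t - s) * D s))"
    by (simp add: sum_distrib_left mult_ac)
  have "average_cost f ((\<Sum>t\<le>m. \<alpha> t *\<^sub>R zbar t) /\<^sub>R A) - average_cost f w \<le>
      ((norm (xbar 0 - w))\<^sup>2 + G\<^sup>2 * (\<Sum>t\<le>m. (\<alpha> t)\<^sup>2)) / (2 * A) + G * (\<Sum>t\<le>m. \<alpha> t * \<delta> t) / A"
    unfolding A_def \<delta>_def
    by (rule ergodic_descent_bound[where f = f and z = z and g = g and zb = zbar and xb = xbar];
        (rule convex g_le \<alpha>_pos xbar_step; assumption)?)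
      (use subgrad bounded in \<open>auto simp: subgradient_steps_def
        subgradient_bound_at_averages_def z_def zbar_def\<close>)
  also have "G * (\<Sum>t\<le>m. \<alpha> t * \<delta> t) / A \<le>
      G * (2 * \<alpha> 0 * (\<Sum>i\<in>UNIV. norm (zbar 0 - z 0 i)) / real CARD('n) +
      24 / \<eta> * (\<Sum>t<m. \<alpha> (Suc t) * (\<Sum>s\<le>t. \<mu> ^ (t - s) * D s))) / A"
    using A G dev by (intro divide_right_mono mult_left_mono) auto
  finally show ?thesis
    by (simp add: start A_def D_def distrib_left add_divide_distrib mult_ac)
qed

section \<open>Geometric convolutions\<close>

lemma geometric_tail_le:
  fixes \<mu> :: real
  assumes "0 < \<mu>" "\<mu> < 1" and "h \<le> Suc t"
  shows "(\<Sum>s<h. \<mu> ^ (t - s)) \<le> \<mu> ^ (Suc t - h) / (1 - \<mu>)"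
proof -
  have "(\<Sum>s<h. \<mu> ^ (t - s)) = (\<Sum>k<h. \<mu> ^ (t - (h - Suc k)))"
    by (rule sum.nat_diff_reindex[symmetric])
  also have "\<dots> = (\<Sum>k<h. \<mu> ^ (Suc t - h) * \<mu> ^ k)"
    using assms by (intro sum.cong refl) (auto simp flip: power_add intro: arg_cong[where f = "power \<mu>"])
  also have "\<dots> = \<mu> ^ (Suc t - h) * (\<Sum>k<h. \<mu> ^ k)"
    by (simp add: sum_distrib_left)
  also have "(\<Sum>k<h. \<mu> ^ k) \<le> 1 / (1 - \<mu>)"
    using assms by (subst sum_gp_strict) (auto intro: divide_right_mono)
  finally show ?thesis
    using assms by simp
qed

text \<open>
  The terms before \<open>\<lceil>t/2\<rceil>\<close> carry powers of \<open>\<mu>\<close> that are at most \<open>\<mu>\<^bsup>t/2\<^esup>\<close>, which pays for the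
  crude bound \<open>\<alpha> 0\<close>; the later terms have the small step sizes.
\<close>

lemma geometric_convolution_split:
  fixes \<mu> :: real
  assumes \<mu>: "0 < \<mu>" "\<mu> < 1" and \<alpha>: "decseq \<alpha>" "\<And>t. \<alpha> t \<ge> 0"
  shows "(\<Sum>s\<le>t. \<mu> ^ (t - s) * \<alpha> s) \<le>
         (\<alpha> 0 * \<mu> powr (real t / 2) + \<alpha> (nat \<lceil>real t / 2\<rceil>)) / (1 - \<mu>)"
proof -
  define h where "h = nat \<lceil>real t / 2\<rceil>"
  have h: "real t \<le> 2 * real h" "2 * real h < real t + 2"
    unfolding h_def by linarith+
  then have "h \<le> t"
    by linarith
  have "(\<Sum>s<h. \<mu> ^ (t - s) * \<alpha> s) \<le> (\<Sum>s<h. \<mu> ^ (t - s) * \<alpha> 0)"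
    using \<mu> \<alpha> by (intro sum_mono mult_left_mono) (auto simp: decseq_def)
  also have "\<dots> \<le> \<mu> ^ (Suc t - h) / (1 - \<mu>) * \<alpha> 0"
    unfolding sum_distrib_right[symmetric]
    using \<mu> \<alpha> \<open>h \<le> t\<close> by (intro mult_right_mono geometric_tail_le) auto
  also have "\<mu> ^ (Suc t - h) \<le> \<mu> powr (real t / 2)"
  proof -
    have "\<mu> ^ (Suc t - h) = \<mu> powr real (Suc t - h)"
      using \<mu> by (simp add: powr_realpow)
    also have "\<dots> \<le> \<mu> powr (real t / 2)"
      using \<mu> h \<open>h \<le> t\<close> by (intro powr_mono') (auto simp: of_nat_diff)
    finally show ?thesis .
  qed
  finally have early: "(\<Sum>s<h. \<mu> ^ (t - s) * \<alpha> s) \<le> \<mu> powr (real t / 2) / (1 - \<mu>) * \<alpha> 0"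
    using \<mu> \<alpha> by (simp add: divide_right_mono mult_right_mono)
  have "(\<Sum>s\<in>{h..t}. \<mu> ^ (t - s) * \<alpha> s) \<le> (\<Sum>s\<in>{h..t}. \<mu> ^ (t - s) * \<alpha> h)"
    using \<mu> \<alpha> by (intro sum_mono mult_left_mono) (auto simp: decseq_def)
  also have "\<dots> = (\<Sum>s\<in>{h..t}. \<mu> ^ (t - s)) * \<alpha> h"
    by (simp add: sum_distrib_right)
  also have "\<dots> \<le> (\<Sum>s<Suc t. \<mu> ^ (t - s)) * \<alpha> h"
    using \<mu> \<alpha> by (intro mult_right_mono sum_mono2) auto
  also have "\<dots> \<le> 1 / (1 - \<mu>) * \<alpha> h"
    using geometric_tail_le[OF \<mu>, of "Suc t" t] \<alpha> by (intro mult_right_mono) auto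
  finally have late: "(\<Sum>s\<in>{h..t}. \<mu> ^ (t - s) * \<alpha> s) \<le> 1 / (1 - \<mu>) * \<alpha> h" .
  have "{..t} = {..<h} \<union> {h..t}"
    using \<open>h \<le> t\<close> by auto
  then have "(\<Sum>s\<le>t. \<mu> ^ (t - s) * \<alpha> s) =
      (\<Sum>s<h. \<mu> ^ (t - s) * \<alpha> s) + (\<Sum>s\<in>{h..t}. \<mu> ^ (t - s) * \<alpha> s)"
    by (simp add: sum.union_disjoint ivl_disj_int)
  then show ?thesis
    using early late by (simp add: h_def add_divide_distrib mult.commute)
qed

lemma injection_convolution_le:
  fixes \<mu> :: real and g :: "nat \<Rightarrow> 'n::finite \<Rightarrow> 'a::real_normed_vector"
  assumes "0 < \<mu>" and "\<And>s i. s \<le> t \<Longrightarrow> norm (g s i) \<le> G" and "\<And>s. s \<le> t \<Longrightarrow> \<alpha> s \<ge> 0"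
  shows "(\<Sum>s\<le>t. \<mu> ^ (t - s) * (\<Sum>j\<in>UNIV. norm (push_injection \<alpha> g x0 s j))) \<le>
         \<mu> ^ t * (\<Sum>j\<in>UNIV. norm (x0 j - \<alpha> 0 *\<^sub>R g 0 j)) +
         real CARD('n) * G * (\<Sum>s\<le>t. \<mu> ^ (t - s) * \<alpha> s)"
proof -
  define U where "U = (\<Sum>j\<in>UNIV. norm (x0 j - \<alpha> 0 *\<^sub>R g 0 j))"
  have G: "G \<ge> 0"
    using assms(2)[of 0] norm_ge_zero order_trans by blast
  have "(\<Sum>j\<in>UNIV. norm (push_injection \<alpha> g x0 s j)) \<le>
      (if s = 0 then U else 0) + real CARD('n) * G * \<alpha> s" if "s \<le> t" for s
  proof (cases "s = 0")
    case True
    then show ?thesis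
      using G assms(3)[of 0] by (simp add: push_injection_def U_def)
  next
    case False
    have "(\<Sum>j\<in>UNIV. norm (push_injection \<alpha> g x0 s j)) \<le> (\<Sum>j\<in>(UNIV::'n set). \<alpha> s * G)"
      using False assms that
      by (intro sum_mono) (auto simp: push_injection_def intro!: mult_left_mono)
    then show ?thesis
      using False by (simp add: mult_ac)
  qed
  then have "(\<Sum>s\<le>t. \<mu> ^ (t - s) * (\<Sum>j\<in>UNIV. norm (push_injection \<alpha> g x0 s j))) \<le>
      (\<Sum>s\<le>t. \<mu> ^ (t - s) * ((if s = 0 then U else 0) + real CARD('n) * G * \<alpha> s))"
    using assms by (intro sum_mono mult_left_mono) auto
  also have "\<dots> = (\<Sum>s\<le>t. if s = 0 then \<mu> ^ t * U else 0) +
      real CARD('n) * G * (\<Sum>s\<le>t. \<mu> ^ (t - s) * \<alpha> s)"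
    unfolding sum_distrib_left sum.distrib[symmetric]
    by (intro sum.cong) (auto simp: distrib_left)
  finally show ?thesis
    by (simp add: U_def)
qed

section \<open>Convergence rates for the two step size rules\<close>

text \<open>
  The deviation at time \<open>\<tau> + 1\<close> is governed by the convolution up to time \<open>\<tau>\<close>, but it is weighted
  with \<open>\<alpha>(\<tau>+1)\<close>; replacing this weight by the larger \<open>\<alpha>(\<tau>)\<close> aligns the indices. The sums on
  the right therefore end at \<open>t - 1\<close>, while those from the descent inequality end at \<open>t\<close>.
\<close>

lemma push_diminishing_steps:
  fixes f :: "'n::finite \<Rightarrow> real ^ 'd \<Rightarrow> real" and W :: "nat \<Rightarrow> real ^ 'n ^ 'n"
    and x0 :: "'n \<Rightarrow> real ^ 'd" and \<alpha> :: "nat \<Rightarrow> real" and g :: "nat \<Rightarrow> 'n \<Rightarrow> real ^ 'd"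
  assumes weights: "push_weights E \<beta> W"
    and mixing: "mixing_constant W \<mu>" and \<mu>: "\<mu> > 0"
    and \<eta>: "\<eta> > 0" and y_ge: "\<And>t i. \<eta> \<le> push_y E W t i"
    and convex: "\<And>i. convex_on UNIV (f i)"
    and subgrad: "subgradient_steps UNIV f E W \<alpha> g x0"
    and g_le: "\<And>t i. norm (g t i) \<le> G"
    and bounded: "subgradient_bound_at_averages UNIV G f E W \<alpha> g x0"
    and \<alpha>: "\<And>t. \<alpha> t > 0" "decseq \<alpha>"
  defines "z \<equiv> push_z E W \<alpha> g x0" and "zbar \<equiv> push_zbar E W \<alpha> g x0"
  shows "average_cost f ((\<Sum>\<tau>\<le>t. \<alpha> \<tau> *\<^sub>R zbar \<tau>) /\<^sub>R (\<Sum>\<tau>\<le>t. \<alpha> \<tau>)) - average_cost f w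
           \<le> ((norm (zbar 0 - w))\<^sup>2 + G\<^sup>2 * (\<Sum>\<tau>\<le>t. (\<alpha> \<tau>)\<^sup>2)) / (\<Sum>\<tau>\<le>t. 2 * \<alpha> \<tau>)
             + (2 * G * \<alpha> 0 * (\<Sum>i\<in>UNIV. norm (zbar 0 - z 0 i))) /
                 (real CARD('n) * (\<Sum>\<tau>\<le>t. \<alpha> \<tau>))
             + 32 * G / \<eta> * (\<Sum>i\<in>UNIV. norm (x0 i - \<alpha> 0 *\<^sub>R g 0 i)) *
                 ((\<Sum>\<tau><t. \<alpha> \<tau> * \<mu> ^ \<tau>) / (\<Sum>\<tau>\<le>t. \<alpha> \<tau>))
             + 32 * real CARD('n) * G\<^sup>2 / (\<eta> * (1 - \<mu>)) *
                 ((\<Sum>\<tau><t. \<alpha> \<tau> * (\<alpha> 0 * \<mu> powr (real \<tau> / 2) + \<alpha> (nat \<lceil>real \<tau> / 2\<rceil>)))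
                   / (\<Sum>\<tau>\<le>t. \<alpha> \<tau>))"
proof -
  define A where "A = (\<Sum>\<tau>\<le>t. \<alpha> \<tau>)"
  define U where "U = (\<Sum>i\<in>UNIV. norm (x0 i - \<alpha> 0 *\<^sub>R g 0 i))"
  define C where "C \<tau> = (\<Sum>s\<le>\<tau>. \<mu> ^ (\<tau> - s) * (\<Sum>j\<in>UNIV. norm (push_injection \<alpha> g x0 s j)))" for \<tau>
  define H where "H \<tau> = \<alpha> 0 * \<mu> powr (real \<tau> / 2) + \<alpha> (nat \<lceil>real \<tau> / 2\<rceil>)" for \<tau>
  have \<mu>1: "\<mu> < 1"
    using mixing by (simp add: mixing_constant_def)
  have G: "G \<ge> 0"
    using g_le[of 0] norm_ge_zero order_trans by blast
  have A: "A > 0"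
    unfolding A_def using \<alpha> by (intro sum_pos) auto
  have \<alpha>0: "\<alpha> \<tau> \<ge> 0" for \<tau>
    using \<alpha>(1)[of \<tau>] by simp
  have U: "U \<ge> 0" and H: "H \<tau> \<ge> 0" for \<tau>
    using \<alpha>0 by (simp_all add: U_def H_def sum_nonneg)
  have C_nonneg: "C \<tau> \<ge> 0" for \<tau>
    unfolding C_def using \<mu> by (intro sum_nonneg mult_nonneg_nonneg) auto
  have C_le: "C \<tau> \<le> \<mu> ^ \<tau> * U + real CARD('n) * G * (H \<tau> / (1 - \<mu>))" for \<tau>
  proof -
    have "C \<tau> \<le> \<mu> ^ \<tau> * U + real CARD('n) * G * (\<Sum>s\<le>\<tau>. \<mu> ^ (\<tau> - s) * \<alpha> s)"
      unfolding C_def U_def by (intro injection_convolution_le \<mu> g_le \<alpha>0)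
    also have "\<dots> \<le> \<mu> ^ \<tau> * U + real CARD('n) * G * (H \<tau> / (1 - \<mu>))"
      unfolding H_def
      using G by (intro add_left_mono mult_left_mono geometric_convolution_split \<mu> \<mu>1 \<alpha>(2) \<alpha>0) auto
    finally show ?thesis .
  qed
  have "(\<Sum>\<tau><t. \<alpha> (Suc \<tau>) * C \<tau>) \<le>
      (\<Sum>\<tau><t. \<alpha> \<tau> * (\<mu> ^ \<tau> * U + real CARD('n) * G * (H \<tau> / (1 - \<mu>))))"
    using \<alpha>0 \<alpha>(2) by (intro sum_mono mult_mono C_le C_nonneg) (auto simp: decseq_Suc_iff)
  also have "\<dots> = U * (\<Sum>\<tau><t. \<alpha> \<tau> * \<mu> ^ \<tau>) +
      real CARD('n) * G / (1 - \<mu>) * (\<Sum>\<tau><t. \<alpha> \<tau> * H \<tau>)"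
    by (simp add: sum.distrib sum_distrib_left distrib_left sum_divide_distrib mult_ac)
  finally have conv: "(\<Sum>\<tau><t. \<alpha> (Suc \<tau>) * C \<tau>) \<le> U * (\<Sum>\<tau><t. \<alpha> \<tau> * \<mu> ^ \<tau>) +
      real CARD('n) * G / (1 - \<mu>) * (\<Sum>\<tau><t. \<alpha> \<tau> * H \<tau>)" .
  have "24 * G / \<eta> * (\<Sum>\<tau><t. \<alpha> (Suc \<tau>) * C \<tau>) / A \<le>
      32 * G / \<eta> * (U * (\<Sum>\<tau><t. \<alpha> \<tau> * \<mu> ^ \<tau>) +
      real CARD('n) * G / (1 - \<mu>) * (\<Sum>\<tau><t. \<alpha> \<tau> * H \<tau>)) / A"
    using A G \<eta> \<alpha>0 C_nonneg
    by (intro divide_right_mono mult_mono conv) (auto intro!: sum_nonneg divide_right_mono)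
  also have "\<dots> = 32 * G / \<eta> * U * ((\<Sum>\<tau><t. \<alpha> \<tau> * \<mu> ^ \<tau>) / A) +
      32 * real CARD('n) * G\<^sup>2 / (\<eta> * (1 - \<mu>)) * ((\<Sum>\<tau><t. \<alpha> \<tau> * H \<tau>) / A)"
    using A \<eta> \<mu>1 by (simp add: field_simps power2_eq_square)
  finally have conv': "24 * G / \<eta> * (\<Sum>\<tau><t. \<alpha> (Suc \<tau>) * C \<tau>) / A \<le>
      32 * G / \<eta> * U * ((\<Sum>\<tau><t. \<alpha> \<tau> * \<mu> ^ \<tau>) / A) +
      32 * real CARD('n) * G\<^sup>2 / (\<eta> * (1 - \<mu>)) * ((\<Sum>\<tau><t. \<alpha> \<tau> * H \<tau>) / A)" .
  have "average_cost f ((\<Sum>\<tau>\<le>t. \<alpha> \<tau> *\<^sub>R zbar \<tau>) /\<^sub>R A) - average_cost f w \<le>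
      ((norm (zbar 0 - w))\<^sup>2 + G\<^sup>2 * (\<Sum>\<tau>\<le>t. (\<alpha> \<tau>)\<^sup>2)) / (2 * A) +
      2 * G * \<alpha> 0 * (\<Sum>i\<in>UNIV. norm (zbar 0 - z 0 i)) / (real CARD('n) * A) +
      24 * G / \<eta> * (\<Sum>\<tau><t. \<alpha> (Suc \<tau>) * C \<tau>) / A"
    unfolding A_def C_def z_def zbar_def
    by (rule push_ergodic_bound[OF weights mixing \<mu> \<eta> y_ge convex _ g_le _ \<alpha>(1)])
      (use subgrad bounded in \<open>auto simp: subgradient_steps_def subgradient_bound_at_averages_def\<close>)
  moreover have "(\<Sum>\<tau>\<le>t. 2 * \<alpha> \<tau>) = 2 * A"
    by (simp add: A_def sum_distrib_left)
  ultimately show ?thesis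
    unfolding A_def[symmetric] U_def[symmetric] H_def[symmetric] using conv' by simp
qed

text \<open>
  With steps \<open>1 / \<surd>T\<close> the total weight is \<open>\<surd>T\<close> and the squared steps sum to \<open>1\<close>. In the
  convolution the initial injection is summed over time to at most \<open>1 / (1 - \<mu>)\<close>, which gives the
  rate \<open>1 / T\<close>. The subgradient injections keep the deviation at the order \<open>1 / (\<surd>T (1 - \<mu>))\<close>
  at all times, and this size survives the averaging.
\<close>

lemma push_constant_steps:
  fixes f :: "'n::finite \<Rightarrow> real ^ 'd \<Rightarrow> real" and W :: "nat \<Rightarrow> real ^ 'n ^ 'n"
    and x0 :: "'n \<Rightarrow> real ^ 'd" and \<alpha> :: "nat \<Rightarrow> real" and g :: "nat \<Rightarrow> 'n \<Rightarrow> real ^ 'd"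
  assumes weights: "push_weights E \<beta> W"
    and mixing: "mixing_constant W \<mu>" and \<mu>: "\<mu> > 0"
    and \<eta>: "\<eta> > 0" and y_ge: "\<And>t i. \<eta> \<le> push_y E W t i"
    and convex: "\<And>i. convex_on UNIV (f i)"
    and "T > 0"
    and subgrad: "subgradient_steps {..<T} f E W \<alpha> g x0"
    and g_le: "\<And>t i. t < T \<Longrightarrow> norm (g t i) \<le> G"
    and bounded: "subgradient_bound_at_averages {..<T} G f E W \<alpha> g x0"
    and \<alpha>: "\<And>t. t < T \<Longrightarrow> \<alpha> t = 1 / sqrt (real T)"
  defines "z \<equiv> push_z E W \<alpha> g x0" and "zbar \<equiv> push_zbar E W \<alpha> g x0"
  shows "average_cost f ((\<Sum>\<tau><T. zbar \<tau>) /\<^sub>R real T) - average_cost f w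
           \<le> (2 * G * (\<Sum>i\<in>UNIV. norm (zbar 0 - z 0 i))) / (real CARD('n) * real T)
             + ((norm (zbar 0 - w))\<^sup>2 + G\<^sup>2) / (2 * sqrt (real T))
             + 32 * G / (\<eta> * (1 - \<mu>) * real T) *
                 (\<Sum>i\<in>UNIV. norm (x0 i - (1 / sqrt (real T)) *\<^sub>R g 0 i))
             + 32 * real CARD('n) * G\<^sup>2 / (\<eta> * (1 - \<mu>) * sqrt (real T))"
proof -
  obtain m where T: "T = Suc m"
    using \<open>T > 0\<close> gr0_conv_Suc by blast
  define q where "q = sqrt (real T)"
  define U where "U = (\<Sum>i\<in>UNIV. norm (x0 i - (1 / q) *\<^sub>R g 0 i))"
  define C where "C \<tau> = (\<Sum>s\<le>\<tau>. \<mu> ^ (\<tau> - s) * (\<Sum>j\<in>UNIV. norm (push_injection \<alpha> g x0 s j)))" for \<tau>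
  have q: "q > 0" "q * q = real T"
    using \<open>T > 0\<close> by (simp_all add: q_def)
  have \<mu>1: "\<mu> < 1"
    using mixing by (simp add: mixing_constant_def)
  have G: "G \<ge> 0"
    using g_le[OF \<open>T > 0\<close>] norm_ge_zero order_trans by blast
  have U: "U \<ge> 0"
    by (simp add: U_def sum_nonneg)
  have \<alpha>': "\<alpha> t = 1 / q" if "t \<le> m" for t
    using \<alpha> that by (simp add: q_def T)
  have C_le: "C \<tau> \<le> \<mu> ^ \<tau> * U + real CARD('n) * G * (1 / (1 - \<mu>) * (1 / q))" if "\<tau> \<le> m" for \<tau>
  proof -
    have "C \<tau> \<le> \<mu> ^ \<tau> * (\<Sum>j\<in>UNIV. norm (x0 j - \<alpha> 0 *\<^sub>R g 0 j)) +
        real CARD('n) * G * (\<Sum>s\<le>\<tau>. \<mu> ^ (\<tau> - s) * \<alpha> s)"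
      unfolding C_def using that g_le q by (intro injection_convolution_le \<mu>) (auto simp: T \<alpha>')
    also have "(\<Sum>s\<le>\<tau>. \<mu> ^ (\<tau> - s) * \<alpha> s) = (\<Sum>s<Suc \<tau>. \<mu> ^ (\<tau> - s)) * (1 / q)"
      unfolding sum_distrib_right lessThan_Suc_atMost using that by (intro sum.cong) (auto simp: \<alpha>')
    also have "\<mu> ^ \<tau> * (\<Sum>j\<in>UNIV. norm (x0 j - \<alpha> 0 *\<^sub>R g 0 j)) + real CARD('n) * G * \<dots> \<le>
        \<mu> ^ \<tau> * U + real CARD('n) * G * (1 / (1 - \<mu>) * (1 / q))"
      unfolding U_def using G q \<mu> geometric_tail_le[OF \<mu> \<mu>1, of "Suc \<tau>" \<tau>]
      by (intro add_mono mult_left_mono mult_right_mono) (auto simp: \<alpha>')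
    finally show ?thesis .
  qed
  have C_nonneg: "C \<tau> \<ge> 0" for \<tau>
    unfolding C_def using \<mu> by (intro sum_nonneg mult_nonneg_nonneg) auto
  have "(\<Sum>\<tau><m. C \<tau>) \<le> (\<Sum>\<tau><m. \<mu> ^ \<tau> * U + real CARD('n) * G * (1 / (1 - \<mu>) * (1 / q)))"
    by (intro sum_mono C_le) auto
  also have "\<dots> = (\<Sum>\<tau><m. \<mu> ^ \<tau>) * U + real m * (real CARD('n) * G * (1 / (1 - \<mu>) * (1 / q)))"
    by (simp add: sum.distrib sum_distrib_right)
  also have "\<dots> \<le> 1 / (1 - \<mu>) * U + real T * (real CARD('n) * G * (1 / (1 - \<mu>) * (1 / q)))"
    using \<mu> \<mu>1 U G q
    by (intro add_mono mult_right_mono; (subst sum_gp_strict)?)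
      (auto simp: T intro!: divide_right_mono)
  also have "\<dots> = 1 / (1 - \<mu>) * U + real CARD('n) * G * q / (1 - \<mu>)"
    using q(1) by (simp flip: q(2))
  finally have conv: "(\<Sum>\<tau><m. C \<tau>) \<le> 1 / (1 - \<mu>) * U + real CARD('n) * G * q / (1 - \<mu>)" .
  have "24 * G / \<eta> * (\<Sum>\<tau><m. \<alpha> (Suc \<tau>) * C \<tau>) / q = 24 * G / \<eta> * (\<Sum>\<tau><m. C \<tau>) / real T"
    using q(1) by (simp add: \<alpha>' flip: q(2) sum_divide_distrib)
  also have "\<dots> \<le> 32 * G / \<eta> * (1 / (1 - \<mu>) * U + real CARD('n) * G * q / (1 - \<mu>)) / real T"
    using G \<eta> C_nonneg
    by (intro divide_right_mono mult_mono conv) (auto intro!: sum_nonneg divide_right_mono)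
  also have "\<dots> = 32 * G / (\<eta> * (1 - \<mu>) * real T) * U +
      32 * real CARD('n) * G\<^sup>2 / (\<eta> * (1 - \<mu>) * q)"
  proof -
    define c where "c = 1 - \<mu>"
    have "c > 0"
      using \<mu>1 by (simp add: c_def)
    then show ?thesis
      unfolding c_def[symmetric] using q(1) \<eta>
      by (simp add: field_simps power2_eq_square flip: q(2))
  qed
  finally have conv': "24 * G / \<eta> * (\<Sum>\<tau><m. \<alpha> (Suc \<tau>) * C \<tau>) / q \<le>
      32 * G / (\<eta> * (1 - \<mu>) * real T) * U + 32 * real CARD('n) * G\<^sup>2 / (\<eta> * (1 - \<mu>) * q)" .
  have weighted: "(\<Sum>\<tau>\<le>m. \<alpha> \<tau>) = q" "(\<Sum>\<tau>\<le>m. (\<alpha> \<tau>)\<^sup>2) = 1"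
      "(\<Sum>\<tau>\<le>m. \<alpha> \<tau> *\<^sub>R zbar \<tau>) /\<^sub>R q = (\<Sum>\<tau><T. zbar \<tau>) /\<^sub>R real T"
    using q by (simp_all add: \<alpha>' T lessThan_Suc_atMost power2_eq_square field_simps
        flip: scaleR_sum_right)
  have "average_cost f ((\<Sum>\<tau>\<le>m. \<alpha> \<tau> *\<^sub>R zbar \<tau>) /\<^sub>R (\<Sum>\<tau>\<le>m. \<alpha> \<tau>)) - average_cost f w \<le>
      ((norm (zbar 0 - w))\<^sup>2 + G\<^sup>2 * (\<Sum>\<tau>\<le>m. (\<alpha> \<tau>)\<^sup>2)) / (2 * (\<Sum>\<tau>\<le>m. \<alpha> \<tau>)) +
      2 * G * \<alpha> 0 * (\<Sum>i\<in>UNIV. norm (zbar 0 - z 0 i)) / (real CARD('n) * (\<Sum>\<tau>\<le>m. \<alpha> \<tau>)) +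
      24 * G / \<eta> * (\<Sum>\<tau><m. \<alpha> (Suc \<tau>) * C \<tau>) / (\<Sum>\<tau>\<le>m. \<alpha> \<tau>)"
    unfolding C_def z_def zbar_def
    by (rule push_ergodic_bound[OF weights mixing \<mu> \<eta> y_ge convex])
      (use subgrad bounded g_le q in \<open>auto simp: T lessThan_Suc_atMost \<alpha>'\<close>)
  then have "average_cost f ((\<Sum>\<tau><T. zbar \<tau>) /\<^sub>R real T) - average_cost f w \<le>
      ((norm (zbar 0 - w))\<^sup>2 + G\<^sup>2) / (2 * q) +
      2 * G * (\<Sum>i\<in>UNIV. norm (zbar 0 - z 0 i)) / (real CARD('n) * real T) +
      24 * G / \<eta> * (\<Sum>\<tau><m. \<alpha> (Suc \<tau>) * C \<tau>) / q"
    unfolding weighted using q(1) by (simp add: \<alpha>' mult_ac flip: q(2))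
  then show ?thesis
    unfolding q_def[symmetric] U_def[symmetric] using conv' by linarith
qed

theorem theorem2:
  fixes E :: "nat \<Rightarrow> ('n::finite \<times> 'n) set"
    and W :: "nat \<Rightarrow> real ^ 'n ^ 'n"
    and f :: "'n \<Rightarrow> real ^ 'd \<Rightarrow> real"
    and x0 :: "'n \<Rightarrow> real ^ 'd"
    and zstar :: "real ^ 'd"
    and L :: nat
    and \<beta> G \<eta> \<mu> :: real
  assumes self_arcs: "\<And>t i. (i, i) \<in> E t"
    and weights: "push_weights E \<beta> W"
    and L_pos: "L > 0"
    and connected: "uniformly_strongly_connected E L"
    and convex: "\<And>i. convex_on UNIV (f i)"
    and G_pos: "G > 0"
    and minimizer: "is_arg_min (average_cost f) (\<lambda>_. True) zstar"
    and \<eta>_pos: "\<eta> > 0"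
    and \<eta>_bounds: "\<And>t i. \<eta> \<le> push_y E W t i \<and> push_y E W t i \<le> real CARD('n)"
    and \<eta>_ge: "\<eta> \<ge> 1 / real CARD('n) ^ (CARD('n) * L)"
    and \<mu>_pos: "\<mu> > 0"
    and \<mu>_mixing: "mixing_constant W \<mu>"
    and \<mu>_le: "\<mu> \<le> (1 - 1 / real CARD('n) ^ (CARD('n) * L)) powr (1 / real L)"
  shows
    "(\<forall>(\<alpha> :: nat \<Rightarrow> real) g.
        (\<forall>t. \<alpha> t > 0) \<and> decseq \<alpha> \<and>
        filterlim (\<lambda>t. \<Sum>\<tau>\<le>t. \<alpha> \<tau>) at_top sequentially \<and>
        summable (\<lambda>t. (\<alpha> t)\<^sup>2) \<and>
        subgradient_steps UNIV f E W \<alpha> g x0 \<and>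
        (\<forall>t i. norm (g t i) \<le> G) \<and>
        subgradient_bound_at_averages UNIV G f E W \<alpha> g x0 \<longrightarrow>
        (let z = push_z E W \<alpha> g x0; zbar = push_zbar E W \<alpha> g x0 in
         \<forall>t. average_cost f ((\<Sum>\<tau>\<le>t. \<alpha> \<tau> *\<^sub>R zbar \<tau>) /\<^sub>R (\<Sum>\<tau>\<le>t. \<alpha> \<tau>)) - average_cost f zstar
           \<le> ((norm (zbar 0 - zstar))\<^sup>2 + G\<^sup>2 * (\<Sum>\<tau>\<le>t. (\<alpha> \<tau>)\<^sup>2)) / (\<Sum>\<tau>\<le>t. 2 * \<alpha> \<tau>)
             + (2 * G * \<alpha> 0 * (\<Sum>i\<in>UNIV. norm (zbar 0 - z 0 i))) /
                 (real CARD('n) * (\<Sum>\<tau>\<le>t. \<alpha> \<tau>))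
             + 32 * G / \<eta> * (\<Sum>i\<in>UNIV. norm (x0 i - \<alpha> 0 *\<^sub>R g 0 i)) *
                 ((\<Sum>\<tau><t. \<alpha> \<tau> * \<mu> ^ \<tau>) / (\<Sum>\<tau>\<le>t. \<alpha> \<tau>))
             + 32 * real CARD('n) * G\<^sup>2 / (\<eta> * (1 - \<mu>)) *
                 ((\<Sum>\<tau><t. \<alpha> \<tau> * (\<alpha> 0 * \<mu> powr (real \<tau> / 2) + \<alpha> (nat \<lceil>real \<tau> / 2\<rceil>)))
                   / (\<Sum>\<tau>\<le>t. \<alpha> \<tau>))))
     \<and>
     (\<forall>(T :: nat) (\<alpha> :: nat \<Rightarrow> real) g.
        T > 0 \<and> (\<forall>t<T. \<alpha> t = 1 / sqrt (real T)) \<and>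
        subgradient_steps {..<T} f E W \<alpha> g x0 \<and>
        (\<forall>t<T. \<forall>i. norm (g t i) \<le> G) \<and>
        subgradient_bound_at_averages {..<T} G f E W \<alpha> g x0 \<longrightarrow>
        (let z = push_z E W \<alpha> g x0; zbar = push_zbar E W \<alpha> g x0 in
         average_cost f ((\<Sum>\<tau><T. zbar \<tau>) /\<^sub>R real T) - average_cost f zstar
           \<le> (2 * G * (\<Sum>i\<in>UNIV. norm (zbar 0 - z 0 i))) / (real CARD('n) * real T)
             + ((norm (zbar 0 - zstar))\<^sup>2 + G\<^sup>2) / (2 * sqrt (real T))
             + 32 * G / (\<eta> * (1 - \<mu>) * real T) *
                 (\<Sum>i\<in>UNIV. norm (x0 i - (1 / sqrt (real T)) *\<^sub>R g 0 i))
             + 32 * real CARD('n) * G\<^sup>2 / (\<eta> * (1 - \<mu>) * sqrt (real T))))"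
proof -
  note y_ge = conjunct1[OF \<eta>_bounds]
  show ?thesis
    unfolding Let_def
    by (intro conjI allI impI;
        rule push_diminishing_steps[OF weights \<mu>_mixing \<mu>_pos \<eta>_pos y_ge convex]
          push_constant_steps[OF weights \<mu>_mixing \<mu>_pos \<eta>_pos y_ge convex];
        blast)
qed

end
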